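(* For every $\varphi\in\mathcal G$, the genus-zero free energy is invariant under the action: $\mathcal F_0^{\rm WK}(\mathbf t.\varphi)=\mathcal F_0^{\rm WK}(\mathbf t)$; equivalently $\mathcal F_0^\varphi=\mathcal F_0^{\rm WK}$.
   Context: Let $R$ be a $\mathbb{Q}$-algebra and $\mathcal{G}=V+V^2R[[V]]$ the group of formal power series under composition. For a tuple $\mathbf t=(t_0,t_1,\dots)$ let $B_{\mathbf t}(v)=v-\sum_{i\ge0}t_iv^i/i!$; the right action $\mathbf T=\mathbf t.\varphi$ is defined by $B_{\mathbf T}(V)=\sqrt{\varphi'(V)}\,B_{\mathbf t}(\varphi(V))$. The genus-$g$ WK free energy is $\mathcal F^{\rm WK}_g(\mathbf t)=\sum_{n\ge0}\frac1{n!}\int_{\overline{\mathcal M}_{g,n}}t(\psi_1)\cdots t(\psi_n)$, $t(z)=\sum_it_iz^i$ (in genus 0, $\int_{\overline{\mathcal M}_{0,n}}\psi_1^{i_1}\cdots\psi_n^{i_n}=\binom{n-3}{i_1,\dots,i_n}$). The genus-$g$ WK mapping free energy is $\mathcal F^\varphi_g(\mathbf T):=\mathcal F^{\rm WK}_g(\mathbf T.\varphi^{-1})$. *)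

theory Defs
  imports "HOL-Library.Multiset" "HOL-Computational_Algebra.Formal_Power_Series"
begin

text \<open>A commutative ring R is a Q-algebra iff every positive integer is invertible.
  We interpret rationals in R via the inverses of their denominators.\<close>

definition qalg :: "'a::comm_ring_1 itself \<Rightarrow> bool" where
  "qalg _ \<longleftrightarrow> (\<forall>n::nat. n > 0 \<longrightarrow> (\<exists>u::'a. of_nat n * u = 1))"

definition ninv :: "int \<Rightarrow> 'a::comm_ring_1" where
  "ninv n = (SOME u. of_int n * u = 1)"

definition ratq :: "rat \<Rightarrow> 'a::comm_ring_1" where
  "ratq q = (case quotient_of q of (a, b) \<Rightarrow> of_int a * ninv b)"

text \<open>A monomial t_{i_1} ... t_{i_n} is the multiset of its indices; a formal power series
  in the t_i is its coefficient function on monomials.\<close>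

type_synonym 'a mseries = "nat multiset \<Rightarrow> 'a"

text \<open>Genus-zero intersection numbers int_{M_{0,n}} psi_1^{i_1} ... psi_n^{i_n}
  (zero for unstable n < 3 and when the degree is not n-3).\<close>

definition int0 :: "nat list \<Rightarrow> rat" where
  "int0 xs = (if length xs \<ge> 3 \<and> sum_list xs = length xs - 3
              then fact (length xs - 3) / prod_list (map fact xs) else 0)"

text \<open>F_0^WK = sum_n 1/n! sum_{i_1..i_n} int psi^{i_1}..psi^{i_n} t_{i_1}..t_{i_n};
  the coefficient of the monomial M collects all index sequences with multiset M.\<close>

definition F0WK :: "'a::comm_ring_1 mseries" where
  "F0WK M = ratq ((1 / fact (size M)) * (\<Sum>xs\<in>{xs. mset xs = M}. int0 xs))"

text \<open>Coefficient of the monomial alpha in the product of the affine forms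
  T_i = c i + sum_j a i j t_j, for i running over the list.\<close>

fun lincoef :: "(nat \<Rightarrow> 'a::comm_ring_1) \<Rightarrow> (nat \<Rightarrow> nat \<Rightarrow> 'a) \<Rightarrow> nat list \<Rightarrow> nat multiset \<Rightarrow> 'a" where
  "lincoef c a [] \<alpha> = (if \<alpha> = {#} then 1 else 0)"
| "lincoef c a (i # is) \<alpha> = c i * lincoef c a is \<alpha>
      + (\<Sum>j\<in>set_mset \<alpha>. a i j * lincoef c a is (\<alpha> - {#j#}))"

definition subst_term :: "'a::comm_ring_1 mseries \<Rightarrow> (nat \<Rightarrow> 'a) \<Rightarrow> (nat \<Rightarrow> nat \<Rightarrow> 'a)
    \<Rightarrow> nat multiset \<Rightarrow> nat multiset \<Rightarrow> 'a" where
  "subst_term F c a \<alpha> \<beta> = F \<beta> * lincoef c a (sorted_list_of_multiset \<beta>) \<alpha>"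

text \<open>Substitution F(T) of the affine change of variables T_i = c i + sum_j a i j t_j
  (a formal sum; well-defined when each coefficient receives finitely many contributions).\<close>

definition subst :: "'a::comm_ring_1 mseries \<Rightarrow> (nat \<Rightarrow> 'a) \<Rightarrow> (nat \<Rightarrow> nat \<Rightarrow> 'a) \<Rightarrow> 'a mseries" where
  "subst F c a \<alpha> = (\<Sum>\<beta>\<in>{\<beta>. subst_term F c a \<alpha> \<beta> \<noteq> 0}. subst_term F c a \<alpha> \<beta>)"

definition inG :: "'a::comm_ring_1 fps \<Rightarrow> bool" where
  "inG \<phi> \<longleftrightarrow> fps_nth \<phi> 0 = 0 \<and> fps_nth \<phi> 1 = 1"

definition sqrt_deriv :: "'a::comm_ring_1 fps \<Rightarrow> 'a fps" where
  "sqrt_deriv \<phi> = (THE s. s ^ 2 = fps_deriv \<phi> \<and> fps_nth s 0 = 1)"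

text \<open>T = t.phi, defined by B_T(V) = sqrt(phi'(V)) B_t(phi(V)) with B_t(v) = v - sum_i t_i v^i/i!.
  Comparing coefficients of V^i:
  T_i = i! (delta_{i1} - [V^i] s phi) + sum_k (i!/k!) [V^i](s phi^k) t_k, where s = sqrt(phi').
  act_const gives the constant part, act_lin the coefficient of t_k.\<close>

definition act_const :: "'a::comm_ring_1 fps \<Rightarrow> nat \<Rightarrow> 'a" where
  "act_const \<phi> i = of_nat (fact i) *
     ((if i = 1 then 1 else 0) - fps_nth (sqrt_deriv \<phi> * \<phi>) i)"

definition act_lin :: "'a::comm_ring_1 fps \<Rightarrow> nat \<Rightarrow> nat \<Rightarrow> 'a" where
  "act_lin \<phi> i k = ratq (fact i / fact k) * fps_nth (sqrt_deriv \<phi> * \<phi> ^ k) i"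

end

theory Submission
  imports Defs "HOL-Combinatorics.Multiset_Permutations"
begin

text \<open>
  With \<open>t(x) = \<Sum>\<^sub>i t\<^sub>i x\<^sup>i/i!\<close> one has \<open>F\<^sub>0 = \<Sum>\<^sub>n (n-3)!/n! [x\<^sup>n\<^sup>-\<^sup>3] t(x)\<^sup>n\<close>.
  The action replaces \<open>t(V)\<close> by \<open>T(V) = (V - s \<phi>) + s t(\<phi>)\<close> with \<open>s = sqrt \<phi>'\<close>.
  In the coefficient of a monomial of degree \<open>p+3\<close> and index sum \<open>S\<close>, the powers of
  \<open>V - s \<phi> = V (1 - s \<phi>/V)\<close> add up to the negative binomial series \<open>(s \<phi>/V)\<^sup>-\<^sup>p\<^sup>-\<^sup>1\<close>. It leaves
  \<open>s\<^sup>2 = \<phi>'\<close>, so everything reduces to the residue of \<open>\<phi>' \<phi>\<^sup>S\<^sup>-\<^sup>p\<^sup>-\<^sup>1\<close>, which is \<open>1\<close>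
  for \<open>S = p\<close> and \<open>0\<close> for \<open>S < p\<close> (and for \<open>S > p\<close>, where there is no pole).
\<close>

unbundle fps_syntax

subsection \<open>Rational numbers in a Q-algebra\<close>

text \<open>\<open>qalg\<close> inverts positive naturals only, hence the passage to the absolute
  value of \<open>b\<close>; a sign is absorbed on both sides.\<close>

lemma qalg_cancel:
  assumes "qalg TYPE('a::comm_ring_1)" "b \<noteq> (0::int)" "of_int b * x = of_int b * (y::'a)"
  shows "x = y"
proof -
  obtain u :: 'a where u: "of_nat (nat \<bar>b\<bar>) * u = 1"
    using assms(1,2) unfolding qalg_def by (metis zero_less_abs_iff zero_less_nat_eq)
  have "of_nat (nat \<bar>b\<bar>) * x = of_nat (nat \<bar>b\<bar>) * y"
  proof (cases "b \<ge> 0")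
    case False
    then have "of_nat (nat \<bar>b\<bar>) = - (of_int b :: 'a)" by simp
    then show ?thesis using assms(3) by simp
  qed (use assms(3) in simp)
  then have "u * of_nat (nat \<bar>b\<bar>) * x = u * of_nat (nat \<bar>b\<bar>) * y" by (simp add: mult.assoc)
  then show ?thesis using u by (simp add: mult.commute)
qed

lemma qalg_cancel_nat:
  assumes "qalg TYPE('a::comm_ring_1)" "n \<noteq> (0::nat)" "of_nat n * x = of_nat n * (y::'a)"
  shows "x = y"
  using qalg_cancel[of "int n" x y] assms by simp

text \<open>\<open>ratq\<close> is computed from the reduced fraction. Cross-multiplication makes it
  accessible from any representation of \<open>q\<close>, so that additivity and multiplicativity
  follow by clearing denominators.\<close>

lemma ratq_fraction:
  assumes "qalg TYPE('a::comm_ring_1)" "b \<noteq> (0::int)" "q * of_int b = of_int a"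
  shows "of_int b * ratq q = (of_int a :: 'a)"
proof -
  obtain a' b' where q: "quotient_of q = (a', b')" by fastforce
  have b': "b' > 0" using quotient_of_denom_pos[OF q] .
  have "q = of_int a' / of_int b'" using quotient_of_div[OF q] .
  with assms(3) b' have "of_int (a' * b) = (of_int (a * b') :: rat)"
    by (simp add: field_simps)
  then have eq: "a' * b = a * b'" by (simp only: of_int_eq_iff)
  have "\<exists>u::'a. of_int b' * u = 1"
    using assms(1) b' unfolding qalg_def by (metis of_int_of_nat_eq pos_int_cases)
  then have inv: "of_int b' * (ninv b' :: 'a) = 1"
    unfolding ninv_def by (rule someI_ex)
  have "of_int b * ratq q = (of_int (a' * b) * ninv b' :: 'a)"
    by (simp add: ratq_def q mult_ac)
  also have "\<dots> = of_int a * (of_int b' * ninv b')" by (simp add: eq mult_ac)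
  finally show ?thesis by (simp add: inv)
qed

lemma ratq_eqI:
  assumes "qalg TYPE('a::comm_ring_1)" "b \<noteq> (0::int)" "q * of_int b = of_int a"
    and "of_int b * x = (of_int a :: 'a)"
  shows "ratq q = x"
  using qalg_cancel[OF assms(1,2)] ratq_fraction[OF assms(1-3)] assms(4) by metis

lemma rat_obtain_fraction:
  obtains a b :: int where "b \<noteq> 0" "(q::rat) * of_int b = of_int a"
proof -
  obtain a b where q: "quotient_of q = (a, b)" by fastforce
  then show thesis
    using that[of b a] quotient_of_denom_pos[OF q] quotient_of_div[OF q] by simp
qed

lemma ratq_of_int: "qalg TYPE('a::comm_ring_1) \<Longrightarrow> ratq (of_int n) = (of_int n :: 'a)"
  by (rule ratq_eqI[where b = 1 and a = n]) auto

lemma ratq_of_nat: "qalg TYPE('a::comm_ring_1) \<Longrightarrow> ratq (of_nat n) = (of_nat n :: 'a)"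
  using ratq_of_int[of "int n"] by simp

lemma ratq_0: "qalg TYPE('a::comm_ring_1) \<Longrightarrow> ratq 0 = (0 :: 'a)"
  using ratq_of_int[of 0] by simp

lemma ratq_1: "qalg TYPE('a::comm_ring_1) \<Longrightarrow> ratq 1 = (1 :: 'a)"
  using ratq_of_int[of 1] by simp

lemma ratq_mult:
  assumes "qalg TYPE('a::comm_ring_1)"
  shows "ratq (x * y) = ratq x * (ratq y :: 'a)"
proof -
  obtain a b where x: "b \<noteq> 0" "x * of_int b = of_int a" by (rule rat_obtain_fraction)
  obtain c d where y: "d \<noteq> 0" "y * of_int d = of_int c" by (rule rat_obtain_fraction)
  show ?thesis
  proof (rule ratq_eqI[OF assms, where b = "b * d" and a = "a * c"])
    show "x * y * of_int (b * d) = of_int (a * c)"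
      by (simp add: x(2)[symmetric] y(2)[symmetric])
    have "of_int (b * d) * (ratq x * ratq y) = (of_int b * ratq x) * (of_int d * ratq y :: 'a)"
      by (simp add: mult_ac)
    then show "of_int (b * d) * (ratq x * ratq y) = (of_int (a * c) :: 'a)"
      by (simp add: ratq_fraction[OF assms x] ratq_fraction[OF assms y])
  qed (use x y in simp)
qed

lemma ratq_add:
  assumes "qalg TYPE('a::comm_ring_1)"
  shows "ratq (x + y) = ratq x + (ratq y :: 'a)"
proof -
  obtain a b where x: "b \<noteq> 0" "x * of_int b = of_int a" by (rule rat_obtain_fraction)
  obtain c d where y: "d \<noteq> 0" "y * of_int d = of_int c" by (rule rat_obtain_fraction)
  show ?thesis
  proof (rule ratq_eqI[OF assms, where b = "b * d" and a = "a * d + c * b"])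
    show "(x + y) * of_int (b * d) = of_int (a * d + c * b)"
      by (simp add: x(2)[symmetric] y(2)[symmetric] algebra_simps)
    have "of_int (b * d) * (ratq x + ratq y) =
        of_int d * (of_int b * ratq x) + of_int b * (of_int d * ratq y :: 'a)"
      by (simp add: algebra_simps)
    then show "of_int (b * d) * (ratq x + ratq y) = (of_int (a * d + c * b) :: 'a)"
      by (simp only: ratq_fraction[OF assms x] ratq_fraction[OF assms y]) (simp add: algebra_simps)
  qed (use x y in simp)
qed

lemma ratq_sum:
  assumes "qalg TYPE('a::comm_ring_1)"
  shows "ratq (sum f A) = (\<Sum>x\<in>A. ratq (f x) :: 'a)"
  by (induction A rule: infinite_finite_induct) (simp_all add: ratq_0 ratq_add assms)

subsection \<open>Power series over a commutative ring\<close>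

lemma fps_unit_ex:
  fixes f :: "'a::comm_ring_1 fps"
  assumes "f $ 0 = 1"
  obtains g where "f * g = 1" "g $ 0 = 1"
proof
  show "f * fps_right_inverse f 1 = 1" by (rule fps_right_inverse) (simp add: assms)
qed simp

text \<open>With \<open>h\<close> equal to 1/2 this solves the equation \<open>s ^ 2 = a\<close>
  coefficient by coefficient, starting from the constant term 1.\<close>

fun sqrt_coeff :: "'a::comm_ring_1 \<Rightarrow> (nat \<Rightarrow> 'a) \<Rightarrow> nat \<Rightarrow> 'a" where
  "sqrt_coeff h a 0 = 1"
| "sqrt_coeff h a (Suc n) =
     h * (a (Suc n) - (\<Sum>i\<in>{1..n}. sqrt_coeff h a i * sqrt_coeff h a (Suc n - i)))"

lemma fps_sqrt_ex:
  fixes f :: "'a::comm_ring_1 fps"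
  assumes "qalg TYPE('a)" "f $ 0 = 1"
  shows "\<exists>s. s ^ 2 = f \<and> s $ 0 = 1"
proof -
  obtain h :: 'a where h: "2 * h = 1"
    using assms(1) unfolding qalg_def by (metis of_nat_numeral zero_less_numeral)
  define s where "s = Abs_fps (sqrt_coeff h (fps_nth f))"
  have "(s * s) $ n = f $ n" for n
  proof (cases n)
    case (Suc m)
    have "(s * s) $ n = (\<Sum>i=0..Suc m. s $ i * s $ (Suc m - i))" by (simp add: fps_mult_nth Suc)
    also have "\<dots> = 2 * s $ Suc m + (\<Sum>i\<in>{1..m}. s $ i * s $ (Suc m - i))"
      by (simp add: sum.atLeast_Suc_atMost s_def del: sqrt_coeff.simps(2))
    also have "2 * s $ Suc m = (2 * h) * (f $ Suc m - (\<Sum>i\<in>{1..m}. s $ i * s $ (Suc m - i)))"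
      by (simp add: s_def mult.assoc)
    finally show ?thesis by (simp add: h Suc)
  qed (simp add: s_def assms(2))
  then have "s ^ 2 = f" by (simp add: fps_eq_iff power2_eq_square)
  then show ?thesis by (auto simp: s_def)
qed

text \<open>Factoring \<open>s ^ 2 - r ^ 2\<close> works even with zero divisors: half of
  \<open>s + r\<close> has constant term 1, so it is a unit and cancels.\<close>

lemma fps_sqrt_unique:
  fixes s r :: "'a::comm_ring_1 fps"
  assumes "qalg TYPE('a)" "s ^ 2 = r ^ 2" "s $ 0 = 1" "r $ 0 = 1"
  shows "s = r"
proof -
  obtain h :: 'a where h: "2 * h = 1"
    using assms(1) unfolding qalg_def by (metis of_nat_numeral zero_less_numeral)
  have "(fps_const h * (s + r)) $ 0 = 1" using h by (simp add: assms algebra_simps)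
  then obtain g where g: "fps_const h * (s + r) * g = 1" by (rule fps_unit_ex)
  have "(s - r) * (fps_const h * (s + r) * g) = (s ^ 2 - r ^ 2) * fps_const h * g"
    by (simp add: power2_eq_square algebra_simps)
  then show ?thesis by (simp add: g assms(2))
qed

lemma sqrt_deriv:
  fixes \<phi> :: "'a::comm_ring_1 fps"
  assumes "qalg TYPE('a)" "inG \<phi>"
  shows "sqrt_deriv \<phi> ^ 2 = fps_deriv \<phi>" "sqrt_deriv \<phi> $ 0 = 1"
proof -
  have "fps_deriv \<phi> $ 0 = 1" using assms(2) by (simp add: inG_def)
  then have "\<exists>!s. s ^ 2 = fps_deriv \<phi> \<and> s $ 0 = 1"
    using fps_sqrt_ex[OF assms(1)] fps_sqrt_unique[OF assms(1)] by metis
  then have "sqrt_deriv \<phi> ^ 2 = fps_deriv \<phi> \<and> sqrt_deriv \<phi> $ 0 = 1"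
    unfolding sqrt_deriv_def by (rule theI')
  then show "sqrt_deriv \<phi> ^ 2 = fps_deriv \<phi>" "sqrt_deriv \<phi> $ 0 = 1" by auto
qed

section \<open>Negative binomial series and residues\<close>

lemma fps_power_mult_nth_eq_0:
  fixes y :: "'a::comm_ring_1 fps"
  assumes "y $ 0 = 0" "n < k"
  shows "(y ^ k * f) $ n = 0"
  unfolding fps_mult_nth using assms
  by (intro sum.neutral) (auto simp: startsby_zero_power_prefix)

text \<open>The series of \<open>(1 - y)^(-p-1)\<close>, truncated after \<open>y ^ N\<close> and
  phrased as a divisibility, so that it makes sense in any commutative ring. Multiplying the sum by
  \<open>1 - y\<close> lowers \<open>p\<close> by one, up to a boundary term divisible by
  \<open>y ^ Suc N\<close>.\<close>

lemma truncated_negative_binomial: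
  fixes y :: "'a::comm_ring_1"
  shows "y ^ Suc N dvd (1 - y) ^ Suc p * (\<Sum>j\<le>N. of_nat (p + j choose j) * y ^ j) - 1"
proof (induction p)
  case 0
  have "(1 - y) * (\<Sum>j\<le>N. y ^ j) = 1 - y ^ Suc N"
    by (simp only: one_diff_power_eq lessThan_Suc_atMost)
  then show ?case by simp
next
  case (Suc p)
  have "(1 - y) * (\<Sum>j\<le>N. of_nat (Suc p + j choose j) * y ^ j) =
      (\<Sum>j\<le>N. of_nat (p + j choose j) * y ^ j) - of_nat (Suc p + N choose N) * y ^ Suc N"
  proof (induction N)
    case (Suc N)
    have binom: "of_nat (Suc p + Suc N choose Suc N) =
        of_nat (Suc p + N choose N) + (of_nat (p + Suc N choose Suc N) :: 'a)"
      by simp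
    \<comment> \<open>Here \<open>b\<close> and \<open>c\<close> are the two summands of Pascal's
      rule and \<open>Y\<close> is \<open>y ^ Suc N\<close>; plain variables keep the ring
      normalisation from expanding them.\<close>
    have "(1 - y) * (A + (b + c) * Y) = B + c * Y - (b + c) * (y * Y)"
      if "(1 - y) * A = B - b * Y" for A B b c Y
      using that by (simp add: distrib_left) (simp add: algebra_simps)
    from this[OF Suc.IH] show ?case
      by (simp only: sum.atMost_Suc binom power_Suc[of y "Suc N"])
  qed simp
  note eq = this
  have "P * (1 - y) * A - 1 = (P * B - 1) - Y * (b * P)"
    if "(1 - y) * A = B - b * Y" for P A B b Y
    using that by (simp only: mult.assoc) (simp add: algebra_simps)
  from this[OF eq, of "(1 - y) ^ Suc p"] have "(1 - y) ^ Suc (Suc p) * (\<Sum>j\<le>N. of_nat (Suc p + j choose j) * y ^ j) - 1 =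
      ((1 - y) ^ Suc p * (\<Sum>j\<le>N. of_nat (p + j choose j) * y ^ j) - 1)
      - y ^ Suc N * (of_nat (Suc p + N choose N) * (1 - y) ^ Suc p)"
    by (simp only: power_Suc2[of "1 - y" "Suc p"])
  then show ?case by (simp only:) (intro dvd_diff Suc dvd_triv_left)
qed

text \<open>With \<open>g = V/\<phi>\<close> this says that the residue of \<open>\<phi>' \<phi>\<^sup>-\<^sup>q\<^sup>-\<^sup>1\<close> is \<open>1\<close> for \<open>q = 0\<close>
  and \<open>0\<close> otherwise.\<close>

lemma residue_deriv_power:
  fixes \<psi> g :: "'a::comm_ring_1 fps"
  assumes "qalg TYPE('a)" "\<psi> * g = 1" "\<psi> $ 0 = 1"
  shows "(g ^ Suc q * fps_deriv (fps_X * \<psi>)) $ q = (if q = 0 then 1 else 0)"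
proof -
  have "\<psi> $ 0 * g $ 0 = 1" using assms(2) by (metis fps_mult_nth_0 fps_one_nth)
  then have g0: "g $ 0 = 1" by (simp add: assms(3))
  \<comment> \<open>Differentiating \<open>\<psi> * g = 1\<close> yields the usual derivative of an
    inverse.\<close>
  have "fps_deriv (\<psi> * g) = 0" using assms(2) by simp
  then have "g * (\<psi> * fps_deriv g + fps_deriv \<psi> * g) = 0" by simp
  then have "(\<psi> * g) * fps_deriv g = - (g ^ 2 * fps_deriv \<psi>)"
    by (simp add: algebra_simps power2_eq_square eq_neg_iff_add_eq_0)
  then have dg: "fps_deriv g = - (g ^ 2 * fps_deriv \<psi>)" by (simp add: assms(2))
  have "g ^ Suc q * fps_deriv (fps_X * \<psi>) =
      g ^ q * (\<psi> * g) + fps_X * (fps_deriv \<psi> * g ^ Suc q)"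
    by (simp add: algebra_simps)
  then have eq: "g ^ Suc q * fps_deriv (fps_X * \<psi>) =
      g ^ q + fps_X * (fps_deriv \<psi> * g ^ Suc q)"
    by (simp add: assms(2))
  show ?thesis
  proof (cases q)
    case 0
    then show ?thesis by (simp add: eq g0 assms(3) del: power_Suc)
  next
    case (Suc r)
    \<comment> \<open>The coefficient of \<open>g ^ q\<close> at \<open>q\<close> is read off, up to
      the factor \<open>q\<close>, from the derivative at \<open>r = q - 1\<close>. It cancels the
      second summand of \<open>eq\<close>; dividing by \<open>q\<close> uses the Q-algebra
      structure.\<close>
    have "fps_deriv (g ^ q) = of_nat q * (fps_deriv g * g ^ r)"
      by (simp only: Suc fps_deriv_power fps_of_nat diff_Suc_1 mult.assoc)
    then have "fps_deriv (g ^ q) = - of_nat q * (fps_deriv \<psi> * g ^ Suc q)"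
      by (simp only: dg) (simp add: Suc power2_eq_square mult_ac del: of_nat_Suc)
    then have "fps_deriv (g ^ q) $ r = (- of_nat q * (fps_deriv \<psi> * g ^ Suc q)) $ r"
      by simp
    then have "of_nat q * g ^ q $ q = - of_nat q * ((fps_deriv \<psi> * g ^ Suc q) $ r)"
      by (simp only: fps_deriv_nth minus_mult_left[symmetric] fps_neg_nth fps_of_nat[symmetric]
            fps_mult_left_const_nth Suc Suc_eq_plus1)
    then have "of_nat q * (g ^ q $ q + (fps_deriv \<psi> * g ^ Suc q) $ r) = of_nat q * 0"
      by (simp only: distrib_left) simp
    then have "g ^ q $ q + (fps_deriv \<psi> * g ^ Suc q) $ r = 0"
      using qalg_cancel_nat[OF assms(1), of q] Suc by blast
    then show ?thesis unfolding eq using Suc by (simp del: power_Suc)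
  qed
qed

text \<open>With \<open>\<phi> = X \<psi>\<close> and \<open>y = 1 - s \<psi>\<close> the base
  \<open>X - s \<phi>\<close> is \<open>X y\<close>, so every summand becomes a coefficient at
  \<open>p\<close>. As \<open>y\<close> has no constant term, the sum over \<open>j\<close> acts
  there as \<open>(s \<psi>)^(-p-1)\<close>.\<close>

lemma residue_identity:
  fixes \<phi> s :: "'a::comm_ring_1 fps"
  assumes "qalg TYPE('a)" "inG \<phi>" "s ^ 2 = fps_deriv \<phi>" "s $ 0 = 1"
  shows "(\<Sum>j\<le>p. of_nat (p + j choose j) *
            ((fps_X - s * \<phi>) ^ j * (s ^ (p + 3) * \<phi> ^ S)) $ (p + j)) = (if S = p then 1 else 0)"
proof -
  define \<psi> where "\<psi> = fps_shift 1 \<phi>"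
  have \<psi>0: "\<psi> $ 0 = 1" using assms(2) by (simp add: \<psi>_def inG_def)
  have \<phi>: "\<phi> = fps_X * \<psi>"
    using assms(2) by (auto simp: fps_eq_iff \<psi>_def inG_def)
  obtain g where g: "\<psi> * g = 1" using fps_unit_ex[OF \<psi>0] .
  obtain r where r: "s * r = 1" using fps_unit_ex[OF assms(4)] .
  define y where "y = 1 - s * \<psi>"
  have y0: "y $ 0 = 0" by (simp add: y_def assms(4) \<psi>0)
  define B where "B = (\<Sum>j\<le>p. of_nat (p + j choose j) * y ^ j)"
  have "y ^ Suc p dvd (s * \<psi>) ^ Suc p * B - 1"
    using truncated_negative_binomial[of y p p] by (simp add: B_def y_def)
  then obtain k where k: "(s * \<psi>) ^ Suc p * B = 1 + y ^ Suc p * k"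
    by (metis dvd_def add.commute diff_add_cancel)
  have "(s * \<psi>) * (r * g) = 1" using g r by (metis mult.assoc mult.left_commute mult_1)
  then have "(r * g) ^ Suc p * (s * \<psi>) ^ Suc p = 1"
    by (metis mult.commute power_mult_distrib power_one)
  \<comment> \<open>\<open>r * g\<close> inverts \<open>s * \<psi>\<close>; the remainder is a
    multiple of \<open>y ^ Suc p\<close>, hence invisible in the coefficient at
    \<open>p\<close>.\<close>
  then have B: "B = (r * g) ^ Suc p + y ^ Suc p * (k * (r * g) ^ Suc p)"
    using k by (metis (no_types, lifting) distrib_left mult.assoc mult.commute mult_1 mult.right_neutral)
  have rs: "r ^ Suc p * s ^ (p + 3) = fps_deriv \<phi>"
  proof -
    have "r ^ Suc p * s ^ (p + 3) = (s * r) ^ Suc p * s ^ 2"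
      unfolding power_mult_distrib by (simp add: power_add eval_nat_numeral algebra_simps)
    then show ?thesis by (simp add: r assms(3))
  qed
  have "((fps_X - s * \<phi>) ^ j * (s ^ (p + 3) * \<phi> ^ S)) $ (p + j) =
      (y ^ j * (s ^ (p + 3) * \<phi> ^ S)) $ p" for j
  proof -
    have "fps_X - s * \<phi> = fps_X * y" by (simp add: \<phi> y_def algebra_simps)
    then have "(fps_X - s * \<phi>) ^ j * (s ^ (p + 3) * \<phi> ^ S) =
        fps_X ^ j * (y ^ j * (s ^ (p + 3) * \<phi> ^ S))"
      by (simp add: power_mult_distrib mult.assoc)
    then show ?thesis by (simp add: fps_X_power_mult_nth)
  qed
  then have "(\<Sum>j\<le>p. of_nat (p + j choose j) *
            ((fps_X - s * \<phi>) ^ j * (s ^ (p + 3) * \<phi> ^ S)) $ (p + j)) =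
      (B * (s ^ (p + 3) * \<phi> ^ S)) $ p"
    by (simp add: B_def sum_distrib_right fps_sum_nth mult.assoc
          fps_of_nat[symmetric] del: fps_const_mult_left)
  also have "B * (s ^ (p + 3) * \<phi> ^ S) =
      g ^ Suc p * (r ^ Suc p * s ^ (p + 3)) * \<phi> ^ S
      + y ^ Suc p * (k * (r * g) ^ Suc p * (s ^ (p + 3) * \<phi> ^ S))"
    unfolding B by (simp only: power_mult_distrib[of r g] power_mult_distrib[of g r] distrib_left distrib_right mult_ac)
  also have "\<dots> $ p = (g ^ Suc p * fps_deriv \<phi> * \<phi> ^ S) $ p"
    using fps_power_mult_nth_eq_0[OF y0, of p "Suc p"] by (simp only: fps_add_nth rs) simp
  also have "g ^ Suc p * fps_deriv \<phi> * \<phi> ^ S = fps_X ^ S * (\<psi> ^ S * g ^ Suc p * fps_deriv \<phi>)"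
    unfolding \<phi> power_mult_distrib by (simp only: mult_ac)
  also have "\<dots> $ p = (if S = p then 1 else 0)"
  \<comment> \<open>For \<open>S \<le> p\<close> the powers of \<psi> and \<open>g\<close> cancel
    down to the residue with \<open>q = p - S\<close>; otherwise the factor \<open>X ^ S\<close>
    kills the coefficient.\<close>
  proof (cases "S \<le> p")
    case True
    have "\<psi> ^ S * g ^ Suc p = (\<psi> * g) ^ S * g ^ Suc (p - S)"
      unfolding power_mult_distrib mult.assoc power_add[symmetric] using True by simp
    then have "\<psi> ^ S * g ^ Suc p = g ^ Suc (p - S)" by (simp add: g)
    then show ?thesis
      using True residue_deriv_power[OF assms(1) g \<psi>0, of "p - S"]
      by (auto simp: fps_X_power_mult_nth \<phi>[symmetric] simp del: power_Suc)
  qed (simp add: fps_X_power_mult_nth)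
  finally show ?thesis .
qed

subsection \<open>Coefficients of products of affine forms\<close>

lemma lincoef_Cons_cong:
  "lincoef c a xs = lincoef c a ys \<Longrightarrow> lincoef c a (i # xs) = lincoef c a (i # ys)"
  by (rule ext) simp

text \<open>After expanding both leading forms, the quadratic part is a sum over the ways to remove
  two variables from \<alpha> in order, and this is symmetric.\<close>

lemma lincoef_swap: "lincoef c a (i # j # xs) = lincoef c a (j # i # xs)"
proof
  fix \<alpha>
  let ?L = "lincoef c a xs"
  \<comment> \<open>The inner range is enlarged to all of \<alpha> with an indicator so that the
    sums can be exchanged; testing membership in \<open>\<alpha> - {#k#}\<close> accounts for
    repeated variables.\<close>
  define D where "D i j = (\<Sum>k\<in>set_mset \<alpha>. \<Sum>l\<in>set_mset \<alpha>.
    if l \<in># \<alpha> - {#k#} then a i k * (a j l * ?L (\<alpha> - {#k#} - {#l#})) else 0)" for i j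
  have D: "(\<Sum>k\<in>set_mset \<alpha>. a i k * (\<Sum>l\<in>set_mset (\<alpha> - {#k#}). a j l * ?L (\<alpha> - {#k#} - {#l#}))) = D i j"
    for i j
    unfolding D_def sum_distrib_left
    by (intro sum.cong refl sum.mono_neutral_cong_left) (auto dest: in_diffD)
  have "D i j = D j i"
    unfolding D_def
    by (subst sum.swap, intro sum.cong refl)
      (auto simp: add_mset_commute mult_ac in_diff_count split: if_splits)
  moreover define S where "S i = (\<Sum>k\<in>set_mset \<alpha>. a i k * ?L (\<alpha> - {#k#}))" for i
  have "lincoef c a (i # j # xs) \<alpha> = c i * c j * ?L \<alpha> + c i * S j + c j * S i + D i j" for i j
    by (simp add: D[symmetric] S_def distrib_left sum.distrib) (simp add: sum_distrib_left mult_ac)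
  ultimately show "lincoef c a (i # j # xs) \<alpha> = lincoef c a (j # i # xs) \<alpha>"
    by (simp add: mult_ac add_ac del: lincoef.simps)
qed

lemma lincoef_remove1:
  "x \<in> set xs \<Longrightarrow> lincoef c a xs = lincoef c a (x # remove1 x xs)"
proof (induction xs)
  case (Cons y ys)
  show ?case
  proof (cases "x = y")
    case False
    with Cons have "lincoef c a (y # ys) = lincoef c a (y # x # remove1 x ys)"
      by (intro lincoef_Cons_cong) auto
    with False show ?thesis by (simp add: lincoef_swap[of c a y x] del: lincoef.simps)
  qed simp
qed simp

text \<open>Frees \<open>subst_term\<close> from its sorted list, so that sums may run over all
  index lists.\<close>

lemma lincoef_mset_cong:
  "mset xs = mset ys \<Longrightarrow> lincoef c a xs = lincoef c a ys"
proof (induction xs arbitrary: ys)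
  case (Cons x xs)
  then have "x \<in> set ys" by (metis list.set_intros(1) set_mset_mset)
  moreover from Cons.prems have "mset xs = mset (remove1 x ys)"
    by (metis add_mset_remove_trivial mset.simps(2) mset_remove1)
  ultimately show ?case
    using lincoef_remove1[of x ys c a] lincoef_Cons_cong[OF Cons.IH] by metis
qed simp

text \<open>A factor contributing its constant has index at least 2, and one contributing a linear
  term uses up a variable of \<alpha>. When the index sum is the length minus 3, this bounds the
  length: the source of finiteness.\<close>

lemma lincoef_nonzero_bound:
  assumes "c 0 = 0" "c 1 = 0" "lincoef c a xs \<alpha> \<noteq> 0"
  shows "2 * length xs \<le> sum_list xs + 2 * size \<alpha>"
  using assms(3)
proof (induction xs arbitrary: \<alpha>)
  case (Cons i xs)
  have "c i * lincoef c a xs \<alpha> \<noteq> 0 \<or>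
      (\<exists>j\<in>#\<alpha>. a i j * lincoef c a xs (\<alpha> - {#j#}) \<noteq> 0)"
    using Cons.prems by (auto intro: ccontr)
  then show ?case
  proof
    assume nz: "c i * lincoef c a xs \<alpha> \<noteq> 0"
    then have "lincoef c a xs \<alpha> \<noteq> 0" "i \<noteq> 0" "i \<noteq> 1"
      using assms(1,2) by (metis mult_zero_left mult_zero_right)+
    then show ?thesis using Cons.IH[of \<alpha>] by simp
  next
    assume "\<exists>j\<in>#\<alpha>. a i j * lincoef c a xs (\<alpha> - {#j#}) \<noteq> 0"
    then obtain j where j: "j \<in># \<alpha>" "lincoef c a xs (\<alpha> - {#j#}) \<noteq> 0"
      by (metis mult_zero_right)
    then have "size \<alpha> = Suc (size (\<alpha> - {#j#}))" by (metis insert_DiffM size_add_mset)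
    then show ?thesis using Cons.IH[OF j(2)] by simp
  qed
qed simp

section \<open>Powers of a single affine form\<close>

lemma card_permutations_of_multiset_rec:
  assumes "\<alpha> \<noteq> {#}"
  shows "card (permutations_of_multiset \<alpha>) =
    (\<Sum>j\<in>set_mset \<alpha>. card (permutations_of_multiset (\<alpha> - {#j#})))"
  unfolding permutations_of_multiset_nonempty[OF assms]
  by (subst card_UN_disjoint) (auto simp: card_image)

text \<open>The binomial theorem: choose the factors that supply variables, distribute \<alpha> over
  them in every order, and take \<open>C\<close> from the rest. Splitting off the first factor gives
  Pascal's rule.\<close>

lemma lincoef_constant_forms:
  "lincoef (\<lambda>_. C) (\<lambda>_. A) (replicate n i) \<alpha> =
    of_nat (n choose size \<alpha>) * of_nat (card (permutations_of_multiset \<alpha>)) *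
    C ^ (n - size \<alpha>) * (\<Prod>j\<in>#\<alpha>. A j)"
proof (induction n arbitrary: \<alpha>)
  case 0
  show ?case by (cases \<alpha>) simp_all
next
  case (Suc n)
  show ?case
  proof (cases "\<alpha> = {#}")
    case False
    define m where "m = size \<alpha> - 1"
    have m: "size \<alpha> = Suc m" using False by (simp add: m_def nonempty_has_size)
    let ?W = "\<lambda>\<alpha>. of_nat (card (permutations_of_multiset \<alpha>)) :: 'a"
    let ?P = "\<Prod>j\<in>#\<alpha>. A j"
    have step: "A j * lincoef (\<lambda>_. C) (\<lambda>_. A) (replicate n i) (\<alpha> - {#j#}) =
        of_nat (n choose m) * C ^ (n - m) * ?P * ?W (\<alpha> - {#j#})" if "j \<in># \<alpha>" for j
    proof -
      have "?P = A j * (\<Prod>j\<in>#\<alpha> - {#j#}. A j)"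
        using that by (metis image_mset_add_mset insert_DiffM prod_mset.add_mset)
      moreover have "size (\<alpha> - {#j#}) = m" using that m by (simp add: size_Diff_singleton)
      ultimately show ?thesis by (simp add: Suc.IH mult_ac)
    qed
    \<comment> \<open>The exponent \<open>n - Suc m\<close> is truncated when \<open>Suc m\<close>
      exceeds \<open>n\<close>, but then the binomial coefficient vanishes.\<close>
    have C: "of_nat (n choose Suc m) * (C * C ^ (n - Suc m)) = of_nat (n choose Suc m) * C ^ (n - m)"
    proof (cases "Suc m \<le> n")
      case True
      then have "n - m = Suc (n - Suc m)" by simp
      then show ?thesis by simp
    qed (simp add: binomial_eq_0)
    have "lincoef (\<lambda>_. C) (\<lambda>_. A) (replicate (Suc n) i) \<alpha> =
        of_nat (n choose Suc m) * (C * C ^ (n - Suc m)) * ?W \<alpha> * ?P +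
        (\<Sum>j\<in>set_mset \<alpha>. of_nat (n choose m) * C ^ (n - m) * ?P * ?W (\<alpha> - {#j#}))"
      by (simp only: replicate_Suc lincoef.simps step cong: sum.cong)
        (simp add: Suc.IH m mult_ac)
    also have "\<dots> = of_nat (n choose Suc m) * C ^ (n - m) * ?W \<alpha> * ?P +
        of_nat (n choose m) * C ^ (n - m) * ?P * ?W \<alpha>"
      unfolding C by (simp add: card_permutations_of_multiset_rec[OF False] sum_distrib_left)
    finally show ?thesis by (simp add: m algebra_simps)
  qed (simp add: Suc.IH)
qed

lemma finite_compositions: "finite {xs::nat list. length xs = n \<and> sum_list xs = d}"
proof (rule finite_subset)
  show "{xs::nat list. length xs = n \<and> sum_list xs = d} \<subseteq> {xs. set xs \<subseteq> {..d} \<and> length xs = n}"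
    using member_le_sum_list by fastforce
qed (simp add: finite_lists_length_eq)

lemma sum_compositions_Suc:
  fixes d :: nat
  shows "(\<Sum>xs | length xs = Suc n \<and> sum_list xs = d. f xs) =
    (\<Sum>i\<le>d. \<Sum>xs | length xs = n \<and> sum_list xs = d - i. f (i # xs))"
proof -
  have "{xs. length xs = Suc n \<and> sum_list xs = d} =
      (\<lambda>(i, xs). i # xs) ` (SIGMA i:{..d}. {xs. length xs = n \<and> sum_list xs = d - i})"
    by (auto simp: image_iff length_Suc_conv)
  moreover have "inj_on (\<lambda>(i, xs). i # xs) X" for X :: "(nat \<times> nat list) set"
    by (auto simp: inj_on_def)
  ultimately show ?thesis
    by (simp only: sum.reindex) (simp add: sum.Sigma finite_compositions case_prod_beta)
qed

text \<open>The generating series \<open>\<Sum>\<^sub>i w\<^sub>i T\<^sub>i V\<^sup>i\<close> of the affine forms is itself an affine form in the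
  \<open>t\<^sub>j\<close>, with power series \<open>C\<close> and \<open>A j\<close> as coefficients, so its powers are again given by \<open>lincoef\<close>.\<close>

lemma lincoef_generating_series_nth:
  fixes C :: "'a::comm_ring_1 fps"
  assumes "\<And>i. C $ i = w i * c i" "\<And>i j. A j $ i = w i * a i j"
  shows "lincoef (\<lambda>_. C) (\<lambda>_. A) (replicate n k) \<alpha> $ d =
    (\<Sum>xs | length xs = n \<and> sum_list xs = d. prod_list (map w xs) * lincoef c a xs \<alpha>)"
proof (induction n arbitrary: \<alpha> d)
  case 0
  have "{xs::nat list. length xs = 0 \<and> sum_list xs = d} = (if d = 0 then {[]} else {})" by auto
  then show ?case by simp
next
  case (Suc n)
  let ?S = "\<lambda>i. {xs. length xs = n \<and> sum_list xs = d - i}"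
  let ?w = "\<lambda>xs. prod_list (map w xs)"
  have "lincoef (\<lambda>_. C) (\<lambda>_. A) (replicate (Suc n) k) \<alpha> $ d =
      (\<Sum>i\<le>d. w i * c i * (\<Sum>xs\<in>?S i. ?w xs * lincoef c a xs \<alpha>)) +
      (\<Sum>j\<in>set_mset \<alpha>. \<Sum>i\<le>d. w i * a i j * (\<Sum>xs\<in>?S i. ?w xs * lincoef c a xs (\<alpha> - {#j#})))"
    by (simp add: fps_sum_nth fps_mult_nth atLeast0AtMost Suc.IH assms)
  \<comment> \<open>Moving the sum over \<open>j\<close> inside reassembles the linear part of
    \<open>lincoef\<close> on \<open>i # xs\<close>.\<close>
  also have "(\<Sum>j\<in>set_mset \<alpha>. \<Sum>i\<le>d. w i * a i j * (\<Sum>xs\<in>?S i. ?w xs * lincoef c a xs (\<alpha> - {#j#}))) =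
      (\<Sum>i\<le>d. \<Sum>xs\<in>?S i. w i * ?w xs * (\<Sum>j\<in>set_mset \<alpha>. a i j * lincoef c a xs (\<alpha> - {#j#})))"
    by (subst sum.swap, simp only: sum_distrib_left, intro sum.cong refl, subst sum.swap)
      (simp add: mult_ac)
  also have "(\<Sum>i\<le>d. w i * c i * (\<Sum>xs\<in>?S i. ?w xs * lincoef c a xs \<alpha>)) +
      (\<Sum>i\<le>d. \<Sum>xs\<in>?S i. w i * ?w xs * (\<Sum>j\<in>set_mset \<alpha>. a i j * lincoef c a xs (\<alpha> - {#j#}))) =
      (\<Sum>i\<le>d. \<Sum>xs\<in>?S i. ?w (i # xs) * lincoef c a (i # xs) \<alpha>)"
    by (simp add: sum_distrib_left sum.distrib[symmetric] distrib_left mult_ac)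
  finally show ?case by (simp only: sum_compositions_Suc)
qed

subsection \<open>The genus zero free energy\<close>

lemma int0_mset:
  "int0 xs = (if size (mset xs) \<ge> 3 \<and> \<Sum>\<^sub># (mset xs) = size (mset xs) - 3
    then fact (size (mset xs) - 3) / (\<Prod>i\<in>#mset xs. fact i) else 0)"
  by (simp add: int0_def sum_mset_sum_list mset_map[symmetric] prod_mset_prod_list del: mset_map)

lemma ratq_inverse_fact_prod:
  assumes "qalg TYPE('a::comm_ring_1)"
  shows "(\<Prod>i\<in>#\<alpha>. ratq (1 / fact i)) = (ratq (1 / (\<Prod>i\<in>#\<alpha>. fact i)) :: 'a)"
  by (induction \<alpha>) (simp_all add: ratq_1 assms ratq_mult[symmetric])

text \<open>Intersection numbers are symmetric, so all orderings of \<alpha> contribute equally and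
  need only be counted. The factors are arranged to match
  \<open>lincoef_constant_forms\<close>.\<close>

lemma F0WK_eq:
  assumes "qalg TYPE('a::comm_ring_1)"
  shows "F0WK \<alpha> = (if size \<alpha> \<ge> 3 \<and> \<Sum>\<^sub># \<alpha> = size \<alpha> - 3
    then ratq (fact (size \<alpha> - 3) / fact (size \<alpha>)) *
      of_nat (card (permutations_of_multiset \<alpha>)) * (\<Prod>i\<in>#\<alpha>. ratq (1 / fact i))
    else 0 :: 'a)"
proof -
  define X :: rat where "X = (if size \<alpha> \<ge> 3 \<and> \<Sum>\<^sub># \<alpha> = size \<alpha> - 3
    then fact (size \<alpha> - 3) / (\<Prod>i\<in>#\<alpha>. fact i) else 0)"
  have "(\<Sum>xs | mset xs = \<alpha>. int0 xs) = (\<Sum>xs | mset xs = \<alpha>. X)"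
    by (intro sum.cong refl) (simp add: int0_mset X_def)
  also have "\<dots> = of_nat (card (permutations_of_multiset \<alpha>)) * X"
    by (simp add: permutations_of_multiset_def)
  finally have "(\<Sum>xs | mset xs = \<alpha>. int0 xs) = of_nat (card (permutations_of_multiset \<alpha>)) *
      (if size \<alpha> \<ge> 3 \<and> \<Sum>\<^sub># \<alpha> = size \<alpha> - 3 then fact (size \<alpha> - 3) / (\<Prod>i\<in>#\<alpha>. fact i) else 0)"
    by (simp only: X_def)
  then show ?thesis
    by (simp add: F0WK_def ratq_inverse_fact_prod[OF assms] ratq_0[OF assms]
          ratq_mult[OF assms, symmetric] ratq_of_nat[OF assms, symmetric] mult_ac)
qed

text \<open>The substituted energy is the sum of \<open>(n-3)!/n! [V^(n-3)] T(V)^n\<close>, where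
  \<open>T(V)\<close> is the affine form with constant part \<open>C\<close> and linear coefficients
  \<open>A j\<close>. The upper limit for \<open>n\<close> comes from
  \<open>lincoef_nonzero_bound\<close>.\<close>

lemma subst_F0WK:
  fixes C :: "'a::comm_ring_1 fps"
  assumes q: "qalg TYPE('a)" and c: "c 0 = 0" "c 1 = 0"
    and C: "\<And>i. C $ i = ratq (1 / fact i) * c i"
    and A: "\<And>i j. A j $ i = ratq (1 / fact i) * a i j"
  shows "finite {\<beta>. subst_term F0WK c a \<alpha> \<beta> \<noteq> 0}"
    and "subst F0WK c a \<alpha> = (\<Sum>n\<in>{3..2 * size \<alpha> - 3}. ratq (fact (n - 3) / fact n) *
      lincoef (\<lambda>_. C) (\<lambda>_. A) (replicate n 0) \<alpha> $ (n - 3))"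
proof -
  define N where "N = 2 * size \<alpha> - 3"
  define L where "L n = {xs::nat list. length xs = n \<and> sum_list xs = n - 3}" for n
  \<comment> \<open>All index lists that can contribute. \<open>U\<close> is closed under
    permutation, so each fibre of \<open>mset\<close> over its image contains every
    ordering.\<close>
  define U where "U = (\<Union>n\<in>{3..N}. L n)"
  let ?supp = "mset ` U"
  have finU: "finite U" by (simp add: U_def L_def finite_compositions)
  have U_mset: "ys \<in> U" if "xs \<in> U" "mset ys = mset xs" for xs ys
  proof -
    have "sum_list ys = sum_list xs" using that(2) by (metis sum_mset_sum_list)
    with that mset_eq_length[OF that(2)] show ?thesis by (auto simp: U_def L_def)
  qed
  have supp: "\<beta> \<in> ?supp" if "subst_term F0WK c a \<alpha> \<beta> \<noteq> 0" for \<beta>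
  proof -
    let ?xs = "sorted_list_of_multiset \<beta>"
    have "F0WK \<beta> \<noteq> (0::'a)" "lincoef c a ?xs \<alpha> \<noteq> 0"
      using that by (auto simp: subst_term_def)
    then have *: "size \<beta> \<ge> 3" "\<Sum>\<^sub># \<beta> = size \<beta> - 3"
        "2 * length ?xs \<le> sum_list ?xs + 2 * size \<alpha>"
      using lincoef_nonzero_bound[OF c] by (auto simp: F0WK_eq[OF q] split: if_splits)
    have len: "length ?xs = size \<beta>" "sum_list ?xs = \<Sum>\<^sub># \<beta>"
      by (metis mset_sorted_list_of_multiset size_mset)
        (metis mset_sorted_list_of_multiset sum_mset_sum_list)
    then have "?xs \<in> U" using * by (auto simp: U_def L_def N_def)
    then show ?thesis by (metis image_eqI mset_sorted_list_of_multiset)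
  qed
  then have sub: "{\<beta>. subst_term F0WK c a \<alpha> \<beta> \<noteq> 0} \<subseteq> ?supp" by auto
  then show "finite {\<beta>. subst_term F0WK c a \<alpha> \<beta> \<noteq> 0}"
    using finU finite_subset by blast
  let ?h = "\<lambda>xs. ratq (int0 xs / fact (length xs)) * lincoef c a xs \<alpha>"
  have term_eq: "subst_term F0WK c a \<alpha> \<beta> = (\<Sum>xs | xs \<in> U \<and> mset xs = \<beta>. ?h xs)"
    if "\<beta> \<in> ?supp" for \<beta>
  proof -
    have eq: "{xs. xs \<in> U \<and> mset xs = \<beta>} = {xs. mset xs = \<beta>}"
      using that U_mset by auto
    have "F0WK \<beta> = (\<Sum>xs | mset xs = \<beta>. ratq (int0 xs / fact (length xs)) :: 'a)"
      unfolding F0WK_def sum_distrib_left ratq_sum[OF q] by (intro sum.cong) auto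
    then have "subst_term F0WK c a \<alpha> \<beta> = (\<Sum>xs | mset xs = \<beta>.
        ratq (int0 xs / fact (length xs)) * lincoef c a (sorted_list_of_multiset \<beta>) \<alpha>)"
      by (simp add: subst_term_def sum_distrib_right)
    also have "\<dots> = (\<Sum>xs | mset xs = \<beta>. ?h xs)"
      by (intro sum.cong refl)
        (metis (mono_tags) lincoef_mset_cong mem_Collect_eq mset_sorted_list_of_multiset)
    finally show ?thesis by (simp add: eq)
  qed
  have "subst F0WK c a \<alpha> = (\<Sum>\<beta>\<in>?supp. subst_term F0WK c a \<alpha> \<beta>)"
    unfolding subst_def using finU sub by (intro sum.mono_neutral_left) auto
  \<comment> \<open>Grouping lists by their multiset absorbs the sum over orderings inside
    \<open>F0WK\<close>.\<close>
  also have "\<dots> = (\<Sum>xs\<in>U. ?h xs)"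
    using sum.group[OF finU, of ?supp mset ?h] finU by (simp add: term_eq)
  also have "\<dots> = (\<Sum>n\<in>{3..N}. \<Sum>xs\<in>L n. ?h xs)"
    unfolding U_def by (rule sum.UNION_disjoint) (auto simp: L_def finite_compositions)
  also have "\<dots> = (\<Sum>n\<in>{3..N}. ratq (fact (n - 3) / fact n) *
      lincoef (\<lambda>_. C) (\<lambda>_. A) (replicate n 0) \<alpha> $ (n - 3))"
  proof (intro sum.cong refl)
    fix n assume n: "n \<in> {3..N}"
    have "ratq (int0 xs / fact (length xs)) =
        ratq (fact (n - 3) / fact n) * (prod_list (map (\<lambda>i. ratq (1 / fact i)) xs) :: 'a)"
      if "xs \<in> L n" for xs
    proof -
      have "prod_list (map (\<lambda>i. ratq (1 / fact i)) xs) = (\<Prod>i\<in>#mset xs. ratq (1 / fact i) :: 'a)"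
        by (simp add: mset_map[symmetric] prod_mset_prod_list del: mset_map)
      also have "\<dots> = ratq (1 / prod_list (map fact xs))"
        unfolding ratq_inverse_fact_prod[OF q]
        by (simp add: mset_map[symmetric] prod_mset_prod_list del: mset_map)
      finally show ?thesis
        using that n by (simp add: L_def int0_def ratq_mult[OF q, symmetric] mult_ac)
    qed
    then show "(\<Sum>xs\<in>L n. ?h xs) = ratq (fact (n - 3) / fact n) *
        lincoef (\<lambda>_. C) (\<lambda>_. A) (replicate n 0) \<alpha> $ (n - 3)"
      unfolding lincoef_generating_series_nth[where w = "\<lambda>i. ratq (1 / fact i)", OF C A]
        sum_distrib_left L_def[symmetric]
      by (intro sum.cong refl) (simp add: mult.assoc)
  qed
  finally show "subst F0WK c a \<alpha> = (\<Sum>n\<in>{3..2 * size \<alpha> - 3}. ratq (fact (n - 3) / fact n) *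
      lincoef (\<lambda>_. C) (\<lambda>_. A) (replicate n 0) \<alpha> $ (n - 3))"
    by (simp only: N_def)
qed

section \<open>Invariance under the action\<close>

text \<open>Both sides are \<open>(p+j)! / ((p+3)! j!)\<close>. This turns the binomial weights of
  the powers into negative binomial ones.\<close>

lemma fact_ratio_binomial:
  "fact (p + j) / fact (p + 3 + j) * of_nat (p + 3 + j choose (p + 3)) =
    (fact p / fact (p + 3) * of_nat (p + j choose j) :: rat)"
proof -
  have "of_nat (p + 3 + j choose (p + 3)) = (fact (p + 3 + j) / (fact (p + 3) * fact j) :: rat)"
    using binomial_fact[of "p + 3" "p + 3 + j", where ?'a = rat] by simp
  moreover have "of_nat (p + j choose j) = (fact (p + j) / (fact j * fact p) :: rat)"
    using binomial_fact[of j "p + j", where ?'a = rat] by simp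
  ultimately show ?thesis by (simp del: fact_Suc)
qed

text \<open>For \<open>n = p + 3 + j\<close>, the \<open>p + 3\<close> variables of \<alpha> come
  from as many factors and the other \<open>j\<close> factors supply \<open>X - s \<phi>\<close>.
  The sum over \<open>j\<close> is \<open>residue_identity\<close>, whose condition
  \<open>S = p\<close> is the dimension constraint in \<open>F0WK\<close>.\<close>

lemma F0WK_act_expansion:
  fixes \<phi> s :: "'a::comm_ring_1 fps"
  assumes q: "qalg TYPE('a)" and G: "inG \<phi>" and s: "s ^ 2 = fps_deriv \<phi>" "s $ 0 = 1"
  defines "A \<equiv> \<lambda>k. fps_const (ratq (1 / fact k)) * (s * \<phi> ^ k)"
  shows "(\<Sum>n\<in>{3..2 * size \<alpha> - 3}. ratq (fact (n - 3) / fact n) *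
      lincoef (\<lambda>_. fps_X - s * \<phi>) (\<lambda>_. A) (replicate n 0) \<alpha> $ (n - 3)) = F0WK \<alpha>"
proof (cases "size \<alpha> \<ge> 3")
  \<comment> \<open>The range of \<open>n\<close> is empty here, and \<open>F0WK\<close> vanishes on
    unstable monomials.\<close>
  case False
  then show ?thesis by (simp add: F0WK_eq[OF q])
next
  case True
  define p where "p = size \<alpha> - 3"
  have m: "size \<alpha> = p + 3" using True by (simp add: p_def)
  define K :: 'a where "K = of_nat (card (permutations_of_multiset \<alpha>)) * (\<Prod>i\<in>#\<alpha>. ratq (1 / fact i))"
  let ?C = "fps_X - s * \<phi>"
  have prod_A: "(\<Prod>k\<in>#\<alpha>. A k) =
      fps_const (\<Prod>k\<in>#\<alpha>. ratq (1 / fact k)) * (s ^ size \<alpha> * \<phi> ^ \<Sum>\<^sub># \<alpha>)" for \<alpha>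
    by (induction \<alpha>) (simp_all add: A_def power_add mult_ac fps_const_mult[symmetric] del: fps_const_mult)
  define E where "E n = (?C ^ (n - (p + 3)) * (s ^ (p + 3) * \<phi> ^ \<Sum>\<^sub># \<alpha>)) $ (n - 3)" for n
  define f where "f n = ratq (fact (n - 3) / fact n) * (of_nat (n choose (p + 3)) * (K * E n))" for n
  have f_eq: "f (p + 3 + j) = K * ratq (fact p / fact (p + 3)) *
      (of_nat (p + j choose j) * (?C ^ j * (s ^ (p + 3) * \<phi> ^ \<Sum>\<^sub># \<alpha>)) $ (p + j))" for j
  proof -
    have "f (p + 3 + j) = ratq (fact (p + j) / fact (p + 3 + j) * of_nat (p + 3 + j choose (p + 3))) *
        (K * E (p + 3 + j))"
      by (simp only: f_def ratq_mult[OF q] ratq_of_nat[OF q] mult.assoc) simp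
    also have "\<dots> = ratq (fact p / fact (p + 3)) * of_nat (p + j choose j) * (K * E (p + 3 + j))"
      by (simp only: fact_ratio_binomial ratq_mult[OF q] ratq_of_nat[OF q])
    finally show ?thesis by (simp add: E_def mult_ac)
  qed
  have "lincoef (\<lambda>_. ?C) (\<lambda>_. A) (replicate n 0) \<alpha> $ (n - 3) =
      of_nat (n choose (p + 3)) * (K * E n)" for n
  proof -
    have "lincoef (\<lambda>_. ?C) (\<lambda>_. A) (replicate n 0) \<alpha> =
        fps_const (of_nat (n choose (p + 3)) * K) * (?C ^ (n - (p + 3)) * (s ^ (p + 3) * \<phi> ^ \<Sum>\<^sub># \<alpha>))"
      unfolding lincoef_constant_forms prod_A m K_def fps_of_nat[symmetric] fps_const_mult[symmetric]
      by (simp only: mult_ac)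
    then show ?thesis by (simp only: fps_mult_left_const_nth E_def mult.assoc)
  qed
  then have "(\<Sum>n\<in>{3..2 * size \<alpha> - 3}. ratq (fact (n - 3) / fact n) *
      lincoef (\<lambda>_. ?C) (\<lambda>_. A) (replicate n 0) \<alpha> $ (n - 3)) = (\<Sum>n\<in>{3..2 * p + 3}. f n)"
    by (simp add: f_def m add.commute)
  also have "\<dots> = (\<Sum>n\<in>{p + 3..2 * p + 3}. f n)"
    by (rule sum.mono_neutral_right) (auto simp: f_def binomial_eq_0)
  \<comment> \<open>The limit \<open>2 * p + 3\<close> becomes \<open>j \<le> p\<close>, exactly the
    truncation in \<open>residue_identity\<close>.\<close>
  also have "\<dots> = (\<Sum>j\<le>p. f (p + 3 + j))"
    by (rule sum.reindex_bij_witness[where i = "\<lambda>j. p + 3 + j" and j = "\<lambda>n. n - (p + 3)"]) auto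
  also have "\<dots> = K * ratq (fact p / fact (p + 3)) * (if \<Sum>\<^sub># \<alpha> = p then 1 else 0)"
    unfolding f_eq sum_distrib_left[symmetric] residue_identity[OF q G s] ..
  also have "\<dots> = F0WK \<alpha>" by (simp add: F0WK_eq[OF q] m K_def mult_ac)
  finally show ?thesis .
qed

text \<open>The finiteness conjunct ensures that \<open>subst\<close> is a genuine sum and not the
  default value 0 over an infinite set.\<close>

theorem mainTheorem3:
  fixes \<phi> :: "'a::comm_ring_1 fps"
  assumes "qalg TYPE('a)"
    and "inG \<phi>"
  shows "(\<forall>\<alpha>. finite {\<beta>. subst_term (F0WK :: 'a mseries) (act_const \<phi>) (act_lin \<phi>) \<alpha> \<beta> \<noteq> 0})
         \<and> subst (F0WK :: 'a mseries) (act_const \<phi>) (act_lin \<phi>) = F0WK"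
proof -
  note q = assms(1)
  let ?s = "sqrt_deriv \<phi>"
  note s = sqrt_deriv[OF assms]
  define A where "A = (\<lambda>k. fps_const (ratq (1 / fact k)) * (?s * \<phi> ^ k))"
  \<comment> \<open>The series \<open>V - s \<phi>\<close> starts in degree 2, because
    \<open>s\<close> and \<open>\<phi>/V\<close> both have constant term 1.\<close>
  have c: "act_const \<phi> 0 = 0" "act_const \<phi> 1 = 0"
    using assms(2) s(2) by (simp_all add: act_const_def inG_def fps_mult_nth)
  have inv: "ratq (1 / fact i) * of_nat (fact i) = (1::'a)" for i
    by (simp add: ratq_of_nat[OF q, symmetric] ratq_mult[OF q, symmetric] ratq_1[OF q])
  \<comment> \<open>Dividing by \<open>i!\<close> identifies the generating series of the action:
    \<open>V - s \<phi>\<close> for the constants and \<open>s \<phi>^j / j!\<close> for the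
    coefficient of \<open>t_j\<close>.\<close>
  have C: "(fps_X - ?s * \<phi>) $ i = ratq (1 / fact i) * act_const \<phi> i" for i
    unfolding act_const_def mult.assoc[symmetric] inv by (simp add: fps_X_def)
  have A: "A j $ i = ratq (1 / fact i) * act_lin \<phi> i j" for i j
  proof -
    have "ratq (1 / fact i) * ratq (fact i / fact j) = (ratq (1 / fact j) :: 'a)"
      by (simp add: ratq_mult[OF q, symmetric])
    then show ?thesis
      unfolding A_def act_lin_def fps_mult_left_const_nth mult.assoc[symmetric, of "ratq (1 / fact i)"]
      by simp
  qed
  note subst = subst_F0WK[OF q c C A]
  show ?thesis
    using subst F0WK_act_expansion[OF assms s, folded A_def] by (auto intro!: ext)
qed

end
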